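(* Let $\mathbb{E}_1,\mathbb{E}_2$ be Euclidean spaces, let $K\subset\mathbb{E}_2$ be a closed, convex cone, let $F:\mathbb{E}_1\to\mathbb{E}_2^\bullet$ be proper and $K$-convex, let $g\in\Gamma(\mathbb{E}_2)$ be such that $g(F(x))\le g(y)$ for all $(x,y)\in K\text{-}\mathrm{epi}\,F$, and let $f\in\Gamma(\mathbb{E}_1)$. Consider the qualification condition $$F\big(\mathrm{ri}(\mathrm{dom}\,f)\cap\mathrm{ri}(\mathrm{dom}\,F)\big)\cap\mathrm{ri}(\mathrm{dom}\,g-K)\neq\emptyset.\qquad(\mathrm{Q})$$ Then the following hold. (a) If (Q) holds, then for all $p\in\mathbb{E}_1$ $$(f+g\circ F)^*(p)=\min_{v\in -K^\circ,\ y\in\mathbb{E}_1}\{g^*(v)+f^*(y)+\langle v,F\rangle^*(p-y)\}$$ (the minimum is attained, possibly with value $+\infty$). (b) For all $\bar x\in\mathrm{dom}\,f\cap\mathrm{dom}(g\circ F)$, $$\partial(f+g\circ F)(\bar x)\supset\partial f(\bar x)+\bigcup_{v\in\partial g(F(\bar x))}\partial\langle v,F\rangle(\bar x),$$ and equality holds under (Q).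
   Context: A Euclidean space is a finite-dimensional real inner product space. A cone is a (nonempty) set $K$ with $\lambda x\in K$ for all $\lambda\ge0$, $x\in K$; its polar is $K^\circ=\{v : \langle v,x\rangle\le 0\ \forall x\in K\}$. $\mathbb{E}_2^\bullet=\mathbb{E}_2\cup\{+\infty_\bullet\}$, where $+\infty_\bullet$ is an adjoined largest element. For $F:\mathbb{E}_1\to\mathbb{E}_2^\bullet$: $\mathrm{dom}\,F=\{x : F(x)\in\mathbb{E}_2\}$, $F$ is proper if $\mathrm{dom}\,F\ne\emptyset$, $K\text{-}\mathrm{epi}\,F=\{(x,v)\in\mathbb{E}_1\times\mathbb{E}_2 : x\in\mathrm{dom}\,F,\ v-F(x)\in K\}$, and $F$ is $K$-convex if this set is convex. $(g\circ F)(x)=g(F(x))$ if $x\in\mathrm{dom}\,F$ and $+\infty$ otherwise; $\langle v,F\rangle(x)=\langle v,F(x)\rangle$ if $x\in\mathrm{dom}\,F$ and $+\infty$ otherwise (also for $v=0$). $\Gamma(\mathbb{E})$ is the set of proper convex functions $\mathbb{E}\to\mathbb{R}\cup\{+\infty\}$. $f^*(y)=\sup_x\{\langle y,x\rangle-f(x)\}$ is the Fenchel conjugate; $\partial f(\bar x)=\{v : f(\bar x)+\langle v,x-\bar x\rangle\le f(x)\ \forall x\}$ for $\bar x\in\mathrm{dom}\,f$ is the subdifferential; $\mathrm{ri}$ is the relative interior. *)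

theory Defs
  imports "HOL-Analysis.Analysis"
begin

text \<open>
  A function with values in the extended space E2 + {top} is a partial map \<open>'a \<rightharpoonup> 'b\<close>, with
  \<open>None\<close> for the adjoined largest element, so its effective domain is the library's \<open>dom\<close>.
\<close>

definition polar :: "'a::real_inner set \<Rightarrow> 'a set" where
  "polar K = {v. \<forall>x\<in>K. v \<bullet> x \<le> 0}"

definition K_epi :: "'b::real_vector set \<Rightarrow> ('a \<rightharpoonup> 'b) \<Rightarrow> ('a \<times> 'b) set" where
  "K_epi K F = {(x, v). \<exists>y. F x = Some y \<and> v - y \<in> K}"

definition proper_ext_map :: "('a \<rightharpoonup> 'b) \<Rightarrow> bool" where
  "proper_ext_map F \<longleftrightarrow> dom F \<noteq> {}"

definition K_convex :: "'b::real_vector set \<Rightarrow> ('a::real_vector \<rightharpoonup> 'b) \<Rightarrow> bool" where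
  "K_convex K F \<longleftrightarrow> convex (K_epi K F)"

definition edom :: "('a \<Rightarrow> ereal) \<Rightarrow> 'a set" where
  "edom f = {x. f x < \<infinity>}"

text \<open>Proper convex functions; convexity of an extended-valued function is that of its epigraph.\<close>

definition proper_convex :: "('a::real_vector \<Rightarrow> ereal) set" where
  "proper_convex = {f. (\<forall>x. f x \<noteq> -\<infinity>) \<and> edom f \<noteq> {} \<and> convex {(x, r::real). f x \<le> ereal r}}"

definition ext_comp :: "('b \<Rightarrow> ereal) \<Rightarrow> ('a \<rightharpoonup> 'b) \<Rightarrow> 'a \<Rightarrow> ereal" where
  "ext_comp g F x = (case F x of Some y \<Rightarrow> g y | None \<Rightarrow> \<infinity>)"

definition scalarization :: "'b::real_inner \<Rightarrow> ('a \<rightharpoonup> 'b) \<Rightarrow> 'a \<Rightarrow> ereal" where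
  "scalarization v F x = (case F x of Some y \<Rightarrow> ereal (v \<bullet> y) | None \<Rightarrow> \<infinity>)"

definition fenchel_conj :: "('a::real_inner \<Rightarrow> ereal) \<Rightarrow> 'a \<Rightarrow> ereal" where
  "fenchel_conj f y = (SUP x. ereal (y \<bullet> x) - f x)"

definition subdiff :: "('a::real_inner \<Rightarrow> ereal) \<Rightarrow> 'a \<Rightarrow> 'a set" where
  "subdiff f x = {v. x \<in> edom f \<and> (\<forall>z. f x + ereal (v \<bullet> (z - x)) \<le> f z)}"

text \<open>
  On sets, binary \<open>-\<close> is set difference, so the Minkowski difference in the qualification
  condition is written out. Since \<open>rel_interior (dom F) \<subseteq> dom F\<close>, the image of \<open>F\<close>
  below never contains \<open>None\<close>.
\<close>

definition qualification ::
  "'b::euclidean_space set \<Rightarrow> ('a::euclidean_space \<Rightarrow> ereal) \<Rightarrow> ('b \<Rightarrow> ereal) \<Rightarrow> ('a \<rightharpoonup> 'b) \<Rightarrow> bool" where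
  "qualification K f g F \<longleftrightarrow>
     F ` (rel_interior (edom f) \<inter> rel_interior (dom F)) \<inter>
     Some ` rel_interior {y - k | y k. y \<in> edom g \<and> k \<in> K} \<noteq> {}"

definition is_minimum :: "'a::order \<Rightarrow> 'a set \<Rightarrow> bool" where
  "is_minimum m A \<longleftrightarrow> m \<in> A \<and> (\<forall>a\<in>A. m \<le> a)"

end

theory Submission
  imports Defs
begin

text \<open>
  With \<open>h = f + g \<circ> F\<close> and \<open>C = K_epi K F\<close>, the monotonicity hypothesis on \<open>g\<close> turns \<open>- h\<^sup>*(p)\<close>
  into the infimum of \<open>f x + g y - p \<bullet> x\<close> over \<open>(x, y) \<in> C\<close>. Perturbing the constraint by a vector
  \<open>z \<in> (dom f \<times> dom g) - C\<close> yields a convex value function, and (Q) says precisely that 0 lies in the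
  relative interior of its domain, because \<open>ri C\<close> consists of the pairs \<open>(x, y)\<close> with
  \<open>x \<in> ri (dom F)\<close> and \<open>y \<in> F x + ri K\<close>. A supporting hyperplane of the epigraph of the value
  function at 0 is therefore not vertical, and its slope is an optimal dual pair. Its component \<open>v\<close>
  lies in \<open>- polar K\<close> since \<open>v\<close> is bounded below on \<open>K\<close>. Part (b) is the case of equality in the
  three Fenchel-Young inequalities.
\<close>

section \<open>Relative interiors of differences and non-vertical supporting hyperplanes\<close>

lemma linear_diff_pair: "linear (\<lambda>(y, k). y - k)"
  by (rule linearI) (auto simp: algebra_simps)

text \<open>The difference set is the image of \<open>S \<times> T\<close> under a linear map, and
  for convex sets the relative interior commutes with products and with linear images.\<close>

lemma rel_interior_minkowski_diff:
  fixes S T :: "'a::euclidean_space set"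
  assumes "convex S" "convex T"
  shows "rel_interior {y - k | y k. y \<in> S \<and> k \<in> T} =
    {y - k | y k. y \<in> rel_interior S \<and> k \<in> rel_interior T}"
proof -
  have *: "{y - k | y k. y \<in> A \<and> k \<in> B} = (\<lambda>(y, k). y - k) ` (A \<times> B)" for A B :: "'a set"
    by auto
  show ?thesis
    unfolding * rel_interior_Times[OF assms, symmetric]
    using rel_interior_convex_linear_image[OF linear_diff_pair convex_Times[OF assms]] by simp
qed

text \<open>\<open>A\<close> plays the role of the epigraph of a convex value function. Since 0 is
  relatively interior to its domain, some point above 0 is relatively interior to \<open>A\<close>.
  A hyperplane supporting \<open>A\<close> at the infimum over 0 separates that point strictly, so
  its last coefficient is positive and can be normalized to 1.\<close>

lemma nonvertical_support:
  fixes A :: "('a::euclidean_space \<times> real) set"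
  assumes "convex A"
    and up: "\<And>z r s. (z, r) \<in> A \<Longrightarrow> r \<le> s \<Longrightarrow> (z, s) \<in> A"
    and ri0: "0 \<in> rel_interior (fst ` A)"
    and lb: "\<And>r. (0, r) \<in> A \<Longrightarrow> \<mu> \<le> r"
  obtains w where "\<And>z r. (z, r) \<in> A \<Longrightarrow> \<mu> \<le> w \<bullet> z + r"
proof -
  define R where "R = {r. (0, r) \<in> A}"
  define \<nu> where "\<nu> = Inf R"
  have "0 \<in> fst ` rel_interior A"
    using rel_interior_convex_linear_image[OF linear_fst \<open>convex A\<close>] ri0 by simp
  then obtain r0 where r0: "(0, r0) \<in> rel_interior A"
    by auto
  then have r0R: "r0 \<in> R"
    using rel_interior_subset unfolding R_def by blast
  have bdd: "bdd_below R"
    using lb unfolding R_def by (auto intro!: bdd_belowI[of _ \<mu>])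
  have \<nu>_le: "\<nu> \<le> r" if "(0, r) \<in> A" for r
    unfolding \<nu>_def using that bdd by (auto simp: R_def intro: cInf_lower)
  have "\<mu> \<le> \<nu>"
    unfolding \<nu>_def using r0R lb by (auto simp: R_def intro!: cInf_greatest)
  have "(0, \<nu>) \<in> closure A"
    unfolding closure_approachable
  proof (intro allI impI)
    fix e :: real assume "0 < e"
    then obtain r where "r \<in> R" "r < \<nu> + e"
      using cInf_lessD[of R "\<nu> + e"] r0R unfolding \<nu>_def by auto
    moreover from this have "\<nu> \<le> r"
      using \<nu>_le by (auto simp: R_def)
    ultimately have "dist (0::'a, r) (0, \<nu>) < e"
      by (simp add: dist_Pair_Pair dist_real_def)
    then show "\<exists>y\<in>A. dist y (0, \<nu>) < e"
      using \<open>r \<in> R\<close> unfolding R_def by blast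
  qed
  moreover have "(0, \<nu>) \<notin> rel_interior A"
  proof
    assume ri: "(0, \<nu>) \<in> rel_interior A"
    then have "(0, \<nu> + 1) \<in> A"
      using rel_interior_subset up[of 0 \<nu> "\<nu> + 1"] by auto
    \<comment> \<open>A relatively interior point allows the segment from
      \<open>(0, \<nu> + 1)\<close> to be prolonged beyond \<open>(0, \<nu>)\<close>. The prolonged
      end has height \<open>\<nu> + 1 - e\<close>, which is below the infimum.\<close>
    then obtain e where "e > 1" "(1 - e) *\<^sub>R (0, \<nu> + 1) + e *\<^sub>R (0, \<nu>) \<in> A"
      using ri convex_rel_interior_iff[OF \<open>convex A\<close>] by (metis empty_iff)
    then show False
      using \<nu>_le[of "(1 - e) * (\<nu> + 1) + e * \<nu>"] by (simp add: algebra_simps)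
  qed
  ultimately obtain a where
    le: "\<And>y. y \<in> closure A \<Longrightarrow> a \<bullet> (0, \<nu>) \<le> a \<bullet> y" and
    less: "\<And>y. y \<in> rel_interior A \<Longrightarrow> a \<bullet> (0, \<nu>) < a \<bullet> y"
    using supporting_hyperplane_relative_frontier[OF \<open>convex A\<close>] by metis
  obtain u t where a: "a = (u, t)"
    by (cases a)
  \<comment> \<open>At \<open>(0, r0)\<close> the component \<open>u\<close> contributes nothing, so
    strict separation there determines the sign of \<open>t\<close>.\<close>
  have "t * \<nu> < t * r0"
    using less[OF r0] by (simp add: a)
  moreover have "\<nu> \<le> r0"
    using \<nu>_le r0R by (simp add: R_def)
  ultimately have "t > 0"
    by (metis linorder_not_less mult_le_cancel_left)
  have "\<mu> \<le> (inverse t *\<^sub>R u) \<bullet> z + r" if "(z, r) \<in> A" for z r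
  proof -
    have "t * \<nu> \<le> u \<bullet> z + t * r"
      using le[of "(z, r)"] that closure_subset by (auto simp: a)
    then have "\<nu> \<le> (inverse t *\<^sub>R u) \<bullet> z + r"
      using \<open>t > 0\<close> by (simp add: field_simps)
    then show ?thesis
      using \<open>\<mu> \<le> \<nu>\<close> by simp
  qed
  then show thesis
    by (rule that)
qed

section \<open>Effective domains and real bounds on Fenchel conjugates\<close>

lemma proper_convexD:
  assumes "f \<in> proper_convex"
  shows "f x \<noteq> -\<infinity>" and "edom f \<noteq> {}" and "convex {(x, r::real). f x \<le> ereal r}"
  using assms by (auto simp: proper_convex_def)

lemma edom_real:
  assumes "x \<in> edom f" "f x \<noteq> -\<infinity>"
  obtains a where "f x = ereal a"
  using assms by (cases "f x") (auto simp: edom_def)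

lemma edom_nonempty_real:
  assumes "edom f \<noteq> {}" "\<And>x. f x \<noteq> -\<infinity>"
  obtains x a where "f x = ereal a"
  using assms edom_real[of _ f] by (metis ex_in_conv)

text \<open>Exhibits the effective domain as a linear image of the epigraph, so that it inherits
  convexity.\<close>

lemma edom_eq_fst_epigraph:
  assumes "\<And>x. f x \<noteq> -\<infinity>"
  shows "edom f = fst ` {(x, r::real). f x \<le> ereal r}"
proof (intro equalityI subsetI)
  fix x assume "x \<in> edom f"
  then obtain a where "f x = ereal a"
    using edom_real[of x f] assms by metis
  then show "x \<in> fst ` {(x, r::real). f x \<le> ereal r}"
    by (intro image_eqI[of _ _ "(x, a)"]) auto
next
  fix x assume "x \<in> fst ` {(x, r::real). f x \<le> ereal r}"
  then obtain r where "f x \<le> ereal r"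
    by auto
  also have "ereal r < \<infinity>"
    by simp
  finally show "x \<in> edom f"
    by (simp add: edom_def)
qed

lemma convex_edom:
  assumes "f \<in> proper_convex"
  shows "convex (edom f)"
  using convex_linear_image[OF linear_fst proper_convexD(3)[OF assms]]
    edom_eq_fst_epigraph[of f, OF proper_convexD(1)[OF assms]] by simp

lemma fenchel_conj_ge: "ereal (y \<bullet> x) - f x \<le> fenchel_conj f y"
  unfolding fenchel_conj_def by (rule SUP_upper) simp

lemma fenchel_conj_not_MInf:
  assumes "edom f \<noteq> {}"
  shows "fenchel_conj f y \<noteq> -\<infinity>"
proof -
  obtain x where "f x < \<infinity>"
    using assms by (auto simp: edom_def)
  then have "ereal (y \<bullet> x) - f x \<noteq> -\<infinity>"
    by (cases "f x") auto
  then show ?thesis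
    using fenchel_conj_ge[of y x f] by auto
qed

text \<open>Only points of finite value matter: where \<open>f\<close> is infinite, the term of the
  supremum is \<open>-\<infinity>\<close>.\<close>

lemma fenchel_conj_le:
  assumes "\<And>x. f x \<noteq> -\<infinity>" and "\<And>x a. f x = ereal a \<Longrightarrow> y \<bullet> x - a \<le> b"
  shows "fenchel_conj f y \<le> ereal b"
  unfolding fenchel_conj_def
proof (rule SUP_least)
  fix x
  show "ereal (y \<bullet> x) - f x \<le> ereal b"
    using assms[of x] by (cases "f x") auto
qed

text \<open>One real bound makes the conjugate finite. The second conclusion describes it as a least
  upper bound among the reals, which keeps later estimates free of infinite values.\<close>

lemma fenchel_conj_realE:
  assumes "\<And>x. f x \<noteq> -\<infinity>" and "edom f \<noteq> {}" and "\<And>x a. f x = ereal a \<Longrightarrow> y \<bullet> x - a \<le> b"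
  obtains c where "fenchel_conj f y = ereal c"
    and "\<And>b. (\<And>x a. f x = ereal a \<Longrightarrow> y \<bullet> x - a \<le> b) \<Longrightarrow> c \<le> b"
proof (cases "fenchel_conj f y")
  case (real c)
  show thesis
    by (rule that[OF real]) (metis fenchel_conj_le[of f, OF assms(1)] real ereal_less_eq(3))
next
  case PInf
  then show ?thesis
    using fenchel_conj_le[of f, OF assms(1,3)] by simp
next
  case MInf
  then show ?thesis
    using fenchel_conj_not_MInf[OF assms(2)] by simp
qed

text \<open>The three variables are independent, so the suprema can be taken one after the other.
  Fixed finite values of the remaining functions supply the bound that makes each conjugate finite
  in turn.\<close>

lemma fenchel_conj_sum3_le:
  assumes "\<And>x. f x \<noteq> -\<infinity>" "\<And>x. g x \<noteq> -\<infinity>" "\<And>x. h x \<noteq> -\<infinity>"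
    and ne: "edom f \<noteq> {}" "edom g \<noteq> {}" "edom h \<noteq> {}"
    and le: "\<And>x a y b z c. f x = ereal a \<Longrightarrow> g y = ereal b \<Longrightarrow> h z = ereal c \<Longrightarrow>
      (p \<bullet> x - a) + (q \<bullet> y - b) + (s \<bullet> z - c) \<le> m"
  shows "fenchel_conj f p + fenchel_conj g q + fenchel_conj h s \<le> ereal m"
proof -
  obtain y0 b0 where g0: "g y0 = ereal b0"
    using edom_nonempty_real[OF ne(2) assms(2)] .
  obtain z0 c0 where h0: "h z0 = ereal c0"
    using edom_nonempty_real[OF ne(3) assms(3)] .
  have "p \<bullet> x - a \<le> m - (q \<bullet> y0 - b0) - (s \<bullet> z0 - c0)" if "f x = ereal a" for x a
    using le[OF that g0 h0] by linarith
  then obtain \<alpha> where \<alpha>: "fenchel_conj f p = ereal \<alpha>"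
    and \<alpha>_le: "\<And>b. (\<And>x a. f x = ereal a \<Longrightarrow> p \<bullet> x - a \<le> b) \<Longrightarrow> \<alpha> \<le> b"
    using fenchel_conj_realE[of f, OF assms(1) ne(1)] by metis
  have \<alpha>_le': "\<alpha> \<le> m - (q \<bullet> y - b) - (s \<bullet> z - c)" if "g y = ereal b" "h z = ereal c" for y b z c
    using \<alpha>_le[of "m - (q \<bullet> y - b) - (s \<bullet> z - c)"] le[OF _ that] by force
  have "q \<bullet> y - b \<le> m - \<alpha> - (s \<bullet> z0 - c0)" if "g y = ereal b" for y b
    using \<alpha>_le'[OF that h0] by linarith
  then obtain \<beta> where \<beta>: "fenchel_conj g q = ereal \<beta>"
    and \<beta>_le: "\<And>b. (\<And>x a. g x = ereal a \<Longrightarrow> q \<bullet> x - a \<le> b) \<Longrightarrow> \<beta> \<le> b"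
    using fenchel_conj_realE[of g, OF assms(2) ne(2)] by metis
  have "s \<bullet> z - c \<le> m - \<alpha> - \<beta>" if "h z = ereal c" for z c
    using \<beta>_le[of "m - \<alpha> - (s \<bullet> z - c)"] \<alpha>_le'[OF _ that] by force
  then have "fenchel_conj h s \<le> ereal (m - \<alpha> - \<beta>)"
    by (rule fenchel_conj_le[of h, OF assms(3)])
  then show ?thesis
    by (cases "fenchel_conj h s") (auto simp: \<alpha> \<beta>)
qed

section \<open>Scalarizations, compositions and weak duality\<close>

lemma scalarization_not_MInf: "scalarization v F x \<noteq> -\<infinity>"
  by (auto simp: scalarization_def split: option.splits)

lemma edom_scalarization: "edom (scalarization v F) = dom F"
  by (auto simp: edom_def scalarization_def split: option.splits)

lemma ext_comp_not_MInf:
  fixes g :: "'b \<Rightarrow> ereal"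
  assumes "\<And>y. g y \<noteq> -\<infinity>"
  shows "ext_comp g F x \<noteq> -\<infinity>"
  using assms by (auto simp: ext_comp_def split: option.splits)

text \<open>Weak duality: the Fenchel-Young inequalities for \<open>g\<close> at \<open>F x\<close>,
  for \<open>f\<close> at \<open>x\<close> and for the scalarization at \<open>x\<close> are added,
  and the terms with \<open>v\<close> and \<open>y\<close> cancel. Where the sum is infinite, the
  term of the supremum is \<open>-\<infinity>\<close>.\<close>

lemma composite_conj_le:
  fixes f :: "'a::real_inner \<Rightarrow> ereal" and g :: "'b::real_inner \<Rightarrow> ereal"
  assumes "\<And>x. f x \<noteq> -\<infinity>" "\<And>y. g y \<noteq> -\<infinity>"
  shows "fenchel_conj (\<lambda>x. f x + ext_comp g F x) p
    \<le> fenchel_conj g v + fenchel_conj f y + fenchel_conj (scalarization v F) (p - y)"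
  unfolding fenchel_conj_def[of "\<lambda>x. f x + ext_comp g F x"]
proof (rule SUP_least)
  fix x
  show "ereal (p \<bullet> x) - (f x + ext_comp g F x)
    \<le> fenchel_conj g v + fenchel_conj f y + fenchel_conj (scalarization v F) (p - y)"
  proof (cases "\<exists>a z b. f x = ereal a \<and> F x = Some z \<and> g z = ereal b")
    case True
    then obtain a z b where *: "f x = ereal a" "F x = Some z" "g z = ereal b"
      by blast
    have "ereal (v \<bullet> z - b) + ereal (y \<bullet> x - a) + ereal ((p - y) \<bullet> x - v \<bullet> z)
      \<le> fenchel_conj g v + fenchel_conj f y + fenchel_conj (scalarization v F) (p - y)"
      using fenchel_conj_ge[of v z g] fenchel_conj_ge[of y x f]
        fenchel_conj_ge[of "p - y" x "scalarization v F"]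
      by (intro add_mono) (auto simp: * scalarization_def)
    then show ?thesis
      by (simp add: * ext_comp_def algebra_simps)
  next
    case False
    have "f x + ext_comp g F x = \<infinity>"
      using False assms ext_comp_not_MInf[of g F x, OF assms(2)]
      by (cases "f x"; cases "F x"; cases "g (the (F x))") (auto simp: ext_comp_def)
    then have "ereal (p \<bullet> x) - (f x + ext_comp g F x) = -\<infinity>"
      by (simp only:) simp
    then show ?thesis
      by (simp only:) simp
  qed
qed

section \<open>The dual cone constraint and attainment in the dual problem\<close>

lemma neg_polar_of_bounded_below:
  assumes "cone K" and "\<And>k. k \<in> K \<Longrightarrow> c \<le> v \<bullet> k"
  shows "v \<in> uminus ` polar K"
proof -
  have "0 \<le> v \<bullet> k" if "k \<in> K" for k
  proof (rule ccontr)
    assume neg: "\<not> 0 \<le> v \<bullet> k"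
    \<comment> \<open>The factor is chosen so that \<open>v \<bullet> (t *\<^sub>R k)\<close> equals
      \<open>- (\<bar>c\<bar> + 1)\<close>, which lies below the bound \<open>c\<close>.\<close>
    define t where "t = (\<bar>c\<bar> + 1) / - (v \<bullet> k)"
    have "t \<ge> 0"
      using neg by (simp add: t_def divide_simps)
    then have "t *\<^sub>R k \<in> K"
      using \<open>cone K\<close> that by (simp add: cone_def)
    moreover have "v \<bullet> (t *\<^sub>R k) = - (\<bar>c\<bar> + 1)"
      using neg by (simp add: t_def divide_simps)
    ultimately show False
      using assms(2)[of "t *\<^sub>R k"] by simp
  qed
  then have "- v \<in> polar K"
    by (simp add: polar_def)
  then show ?thesis
    by force
qed

text \<open>A point is relatively interior to a convex set in a product if its first component is
  relatively interior to the projection and its second to the fiber. Here the projection is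
  \<open>dom F\<close> and the fiber over \<open>x\<close> is the translate of \<open>K\<close> by
  \<open>F x\<close>.\<close>

lemma rel_interior_K_epi:
  fixes K :: "'b::euclidean_space set" and F :: "'a::euclidean_space \<rightharpoonup> 'b"
  assumes "convex (K_epi K F)" "K \<noteq> {}"
    and x: "x \<in> rel_interior (dom F)" and Fx: "F x = Some y" and k: "k \<in> rel_interior K"
  shows "(x, y + k) \<in> rel_interior (K_epi K F)"
proof -
  have fiber: "{v. (x, v) \<in> K_epi K F} = (\<lambda>v. y + v) ` K"
    using Fx by (force simp: K_epi_def image_iff algebra_simps)
  have "\<exists>v. (x', v) \<in> K_epi K F" if "F x' = Some y'" for x' y'
  proof -
    obtain k' where "k' \<in> K"
      using \<open>K \<noteq> {}\<close> by blast
    then have "(x', y' + k') \<in> K_epi K F"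
      using that by (simp add: K_epi_def)
    then show ?thesis ..
  qed
  then have dom: "{x'. {v. (x', v) \<in> K_epi K F} \<noteq> {}} = dom F"
    by (auto simp: K_epi_def)
  show ?thesis
    using rel_interior_projection[OF assms(1) refl, of x "y + k"] x k
    by (simp add: dom fiber rel_interior_translation del: Collect_empty_eq)
qed

text \<open>Strong duality: any real upper bound \<open>m\<close> of the primal conjugate is also
  met by some admissible dual pair. With \<open>m\<close> the conjugate itself, weak duality turns
  this into attainment.\<close>

lemma composite_dual_attained:
  fixes K :: "'b::euclidean_space set" and F :: "'a::euclidean_space \<rightharpoonup> 'b"
  assumes K: "K \<noteq> {}" "convex K" "cone K" and conv: "convex (K_epi K F)"
    and g: "g \<in> proper_convex" and f: "f \<in> proper_convex"
    and mono: "\<And>x y. (x, y) \<in> K_epi K F \<Longrightarrow> ext_comp g F x \<le> g y"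
    and Q: "qualification K f g F"
    and m: "fenchel_conj (\<lambda>x. f x + ext_comp g F x) p \<le> ereal m"
  obtains v y where "v \<in> uminus ` polar K"
    and "fenchel_conj g v + fenchel_conj f y + fenchel_conj (scalarization v F) (p - y) \<le> ereal m"
proof -
  note f_nM = proper_convexD(1)[OF f] and g_nM = proper_convexD(1)[OF g]
  let ?C = "K_epi K F" and ?epf = "{(x, r::real). f x \<le> ereal r}" and ?epg = "{(x, r::real). g x \<le> ereal r}"
  \<comment> \<open>\<open>L\<close> records the violation of the constraint and the objective
    value. \<open>A\<close> is thus a linear image of a convex set and contains every perturbation
    together with the values attainable for it.\<close>
  define L :: "(('a \<times> real) \<times> ('b \<times> real)) \<times> ('a \<times> 'b) \<Rightarrow> ('a \<times> 'b) \<times> real"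
    where "L = (\<lambda>(((x, r), (y, s)), (x', y')). ((x - x', y - y'), r + s - p \<bullet> x))"
  define A where "A = L ` ((?epf \<times> ?epg) \<times> ?C)"
  have A_I: "((x - x', y - y'), t - p \<bullet> x) \<in> A"
    if "f x = ereal a" "g y = ereal b" "(x', y') \<in> ?C" "a + b \<le> t" for x y x' y' a b t
    unfolding A_def using that
    by (intro image_eqI[of _ L "(((x, a), (y, t - a)), (x', y'))"]) (auto simp: L_def)
  have A_E: "\<exists>x y x' y' a b. f x = ereal a \<and> g y = ereal b \<and> (x', y') \<in> ?C \<and>
      z = (x - x', y - y') \<and> a + b \<le> t + p \<bullet> x" if zt: "(z, t) \<in> A" for z t
  proof -
    obtain x r y s x' y' where *: "f x \<le> ereal r" "g y \<le> ereal s" "(x', y') \<in> ?C"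
      "z = (x - x', y - y')" "t = r + s - p \<bullet> x"
      using zt by (auto simp: A_def L_def)
    obtain a b where "f x = ereal a" "g y = ereal b"
      using *(1,2) f_nM[of x] g_nM[of y] by (cases "f x"; cases "g y") auto
    with * show ?thesis
      by (intro exI[of _ x] exI[of _ y] exI[of _ x'] exI[of _ y'] exI[of _ a] exI[of _ b]) auto
  qed
  have "linear L"
    by (rule linearI) (auto simp: L_def algebra_simps inner_add_right)
  then have "convex A"
    unfolding A_def
    by (intro convex_linear_image convex_Times proper_convexD(3)[OF f] proper_convexD(3)[OF g] conv)
  moreover have "(z, s) \<in> A" if zr: "(z, r) \<in> A" and rs: "r \<le> s" for z r s
  proof -
    obtain x y x' y' a b where *: "f x = ereal a" "g y = ereal b" "(x', y') \<in> ?C"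
      "z = (x - x', y - y')" "a + b \<le> r + p \<bullet> x"
      using A_E[OF zr] by blast
    then show ?thesis
      using A_I[OF *(1-3), of "s + p \<bullet> x"] rs by simp
  qed
  moreover have "0 \<in> rel_interior (fst ` A)"
  proof -
    have eq: "fst ` A = {w - c | w c. w \<in> edom f \<times> edom g \<and> c \<in> ?C}"
    proof (intro equalityI subsetI)
      fix z assume "z \<in> fst ` A"
      then obtain t where "(z, t) \<in> A"
        by auto
      then obtain x y x' y' a b where "f x = ereal a" "g y = ereal b" "(x', y') \<in> ?C" "z = (x - x', y - y')"
        using A_E by blast
      then have "(x, y) \<in> edom f \<times> edom g \<and> (x', y') \<in> ?C \<and> z = (x, y) - (x', y')"
        by (simp add: edom_def)
      then show "z \<in> {w - c | w c. w \<in> edom f \<times> edom g \<and> c \<in> ?C}"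
        by blast
    next
      fix z assume "z \<in> {w - c | w c. w \<in> edom f \<times> edom g \<and> c \<in> ?C}"
      then obtain x y x' y' where *: "x \<in> edom f" "y \<in> edom g" "(x', y') \<in> ?C" "z = (x - x', y - y')"
        by auto
      obtain a b where "f x = ereal a" "g y = ereal b"
        using edom_real[OF *(1) f_nM] edom_real[OF *(2) g_nM] by metis
      then show "z \<in> fst ` A"
        using A_I[OF _ _ *(3) order_refl] *(4) by (metis fst_conv imageI)
    qed
    obtain x z where x: "x \<in> rel_interior (edom f)" "x \<in> rel_interior (dom F)" "F x = Some z"
      and "z \<in> rel_interior {y - k | y k. y \<in> edom g \<and> k \<in> K}"
      using Q unfolding qualification_def by (auto simp: image_iff)
    then obtain y k where yk: "y \<in> rel_interior (edom g)" "k \<in> rel_interior K" "z = y - k"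
      unfolding rel_interior_minkowski_diff[OF convex_edom[OF g] K(2)] by blast
    \<comment> \<open>Here \<open>y = F x + k\<close>. The same pair is relatively interior to
      \<open>edom f \<times> edom g\<close>, so 0 is a difference of two relatively interior
      points.\<close>
    have "(x, y) \<in> rel_interior ?C"
      using rel_interior_K_epi[OF conv K(1) x(2,3) yk(2)] yk(3) by simp
    moreover have "(x, y) \<in> rel_interior (edom f \<times> edom g)"
      using x yk by (simp add: rel_interior_Times convex_edom f g)
    ultimately show ?thesis
      unfolding eq rel_interior_minkowski_diff[OF convex_Times[OF convex_edom[OF f] convex_edom[OF g]] conv]
      by force
  qed
  moreover have "- m \<le> r" if r: "(0, r) \<in> A" for r
  proof -
    \<comment> \<open>Without perturbation the pair \<open>(x, y)\<close> itself lies in the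
      K-epigraph, so \<open>g y\<close> dominates the composite at \<open>x\<close> and the bound on
      the conjugate applies.\<close>
    obtain x y a b where *: "f x = ereal a" "g y = ereal b" "(x, y) \<in> ?C" "a + b \<le> r + p \<bullet> x"
      using A_E[OF r] by (auto simp: zero_prod_def)
    have "ereal (p \<bullet> x) - (f x + ext_comp g F x) \<le> ereal m"
      using fenchel_conj_ge m by (rule order_trans)
    moreover have "ext_comp g F x \<le> ereal b"
      using mono[OF *(3)] *(2) by simp
    ultimately have "p \<bullet> x - (a + b) \<le> m"
      using ext_comp_not_MInf[of g F x, OF g_nM] *(1) by (cases "ext_comp g F x") auto
    with *(4) show ?thesis
      by linarith
  qed
  ultimately obtain w where w: "\<And>z r. (z, r) \<in> A \<Longrightarrow> - m \<le> w \<bullet> z + r"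
    using nonvertical_support[of A "- m"] by blast
  obtain u v' where w_eq: "w = (u, v')"
    by (cases w)
  \<comment> \<open>Signs and shift are chosen so that the supporting inequality splits into one
    Fenchel term each for \<open>g\<close>, \<open>f\<close> and the scalarization.\<close>
  define v where "v = - v'"
  define q where "q = p - u"
  have key: "(v \<bullet> y - b) + (q \<bullet> x - a) + ((p - q) \<bullet> x' - v \<bullet> y') \<le> m"
    if "f x = ereal a" "g y = ereal b" "(x', y') \<in> ?C" for x y x' y' a b
    using w[OF A_I[OF that order_refl]]
    by (simp add: w_eq v_def q_def inner_diff_left inner_diff_right)
  obtain x0 a0 where f0: "f x0 = ereal a0"
    using edom_nonempty_real[OF proper_convexD(2)[OF f] f_nM] .
  obtain y0 b0 where g0: "g y0 = ereal b0"
    using edom_nonempty_real[OF proper_convexD(2)[OF g] g_nM] .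
  have dom_ne: "dom F \<noteq> {}"
    using Q rel_interior_subset unfolding qualification_def by blast
  then obtain x1 z1 where F1: "F x1 = Some z1"
    by blast
  show thesis
  proof (rule that)
    show "v \<in> uminus ` polar K"
    proof (rule neg_polar_of_bounded_below[OF K(3)])
      fix k assume "k \<in> K"
      then have "(x1, z1 + k) \<in> ?C"
        using F1 by (simp add: K_epi_def)
      \<comment> \<open>With all other points fixed, moving along \<open>z1 + k\<close> bounds
        \<open>v\<close> from below on \<open>K\<close>.\<close>
      from key[OF f0 g0 this]
      show "(v \<bullet> y0 - b0) + (q \<bullet> x0 - a0) + ((p - q) \<bullet> x1 - v \<bullet> z1) - m \<le> v \<bullet> k"
        by (simp add: inner_add_right)
    qed
    show "fenchel_conj g v + fenchel_conj f q + fenchel_conj (scalarization v F) (p - q) \<le> ereal m"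
    proof (rule fenchel_conj_sum3_le[of g f "scalarization v F",
          OF g_nM f_nM scalarization_not_MInf proper_convexD(2)[OF g] proper_convexD(2)[OF f]])
      show "edom (scalarization v F) \<noteq> {}"
        using dom_ne by (simp add: edom_scalarization)
      fix y b x a x' c
      assume "g y = ereal b" "f x = ereal a" and s: "scalarization v F x' = ereal c"
      obtain z where "F x' = Some z" "c = v \<bullet> z"
        using s by (auto simp: scalarization_def split: option.splits)
      \<comment> \<open>This places the graph of \<open>F\<close> inside its K-epigraph, so
        \<open>key\<close> can be used with \<open>y' = F x'\<close>.\<close>
      moreover have "0 \<in> K"
        using K(1,3) by (simp add: cone_contains_0)
      ultimately show "(v \<bullet> y - b) + (q \<bullet> x - a) + ((p - q) \<bullet> x' - c) \<le> m"
        using key[OF \<open>f x = ereal a\<close> \<open>g y = ereal b\<close>, of x' z] by (simp add: K_epi_def)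
    qed
  qed
qed

text \<open>(Q) provides a point \<open>x\<close> of \<open>edom f\<close> with
  \<open>F x = y - k\<close>. Then \<open>(x, y)\<close> is in the K-epigraph, and monotonicity
  makes the composite finite from above there.\<close>

lemma composite_conj_not_MInf:
  fixes K :: "'b::euclidean_space set" and F :: "'a::euclidean_space \<rightharpoonup> 'b"
  assumes f: "f \<in> proper_convex"
    and mono: "\<And>x y. (x, y) \<in> K_epi K F \<Longrightarrow> ext_comp g F x \<le> g y"
    and Q: "qualification K f g F"
  shows "fenchel_conj (\<lambda>x. f x + ext_comp g F x) p \<noteq> -\<infinity>"
proof (rule fenchel_conj_not_MInf)
  obtain x z where "x \<in> rel_interior (edom f)" and z: "F x = Some z"
    and "z \<in> rel_interior {y - k | y k. y \<in> edom g \<and> k \<in> K}"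
    using Q unfolding qualification_def by (auto simp: image_iff)
  then have x: "x \<in> edom f" and "z \<in> {y - k | y k. y \<in> edom g \<and> k \<in> K}"
    using rel_interior_subset by blast+
  then obtain y k where "y \<in> edom g" "k \<in> K" "z = y - k"
    by blast
  with z have "(x, y) \<in> K_epi K F"
    by (simp add: K_epi_def)
  from mono[OF this] \<open>y \<in> edom g\<close> have "ext_comp g F x < \<infinity>"
    by (auto simp: edom_def)
  with x show "edom (\<lambda>x. f x + ext_comp g F x) \<noteq> {}"
    by (auto simp: edom_def)
qed

text \<open>The subgradient inequality, rearranged, bounds every term of the supremum defining the
  conjugate: this is equality in Fenchel-Young.\<close>

lemma subdiff_iff_fenchel_conj:
  assumes "\<And>x. f x \<noteq> -\<infinity>" "f x = ereal a"
  shows "v \<in> subdiff f x \<longleftrightarrow> fenchel_conj f v \<le> ereal (v \<bullet> x - a)"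
proof -
  have "f x + ereal (v \<bullet> (z - x)) \<le> f z \<longleftrightarrow> ereal (v \<bullet> z) - f z \<le> ereal (v \<bullet> x - a)" for z
    using assms(1)[of z] by (cases "f z") (auto simp: assms(2) inner_diff_right)
  then show ?thesis
    using assms(2) by (simp add: subdiff_def edom_def fenchel_conj_def SUP_le_iff)
qed

section \<open>Conjugate and subdifferential of \<open>f + g \<circ> F\<close>\<close>

theorem corollary16:
  fixes K :: "'b::euclidean_space set"
    and F :: "'a::euclidean_space \<rightharpoonup> 'b"
    and g :: "'b \<Rightarrow> ereal"
    and f :: "'a \<Rightarrow> ereal"
  assumes "K \<noteq> {}" and "closed K" and "convex K" and "cone K"
    and "proper_ext_map F" and "K_convex K F"
    and "g \<in> proper_convex"
    and "\<forall>(x, y)\<in>K_epi K F. ext_comp g F x \<le> g y"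
    and "f \<in> proper_convex"
  shows "(qualification K f g F \<longrightarrow>
           (\<forall>p. is_minimum (fenchel_conj (\<lambda>x. f x + ext_comp g F x) p)
                  {fenchel_conj g v + fenchel_conj f y + fenchel_conj (scalarization v F) (p - y) | v y.
                     v \<in> uminus ` polar K})) \<and>
         (\<forall>x \<in> edom f \<inter> edom (ext_comp g F).
           subdiff f x + (\<Union>v\<in>subdiff g (the (F x)). subdiff (scalarization v F) x)
             \<subseteq> subdiff (\<lambda>x. f x + ext_comp g F x) x \<and>
           (qualification K f g F \<longrightarrow>
             subdiff (\<lambda>x. f x + ext_comp g F x) x =
               subdiff f x + (\<Union>v\<in>subdiff g (the (F x)). subdiff (scalarization v F) x)))"
proof -
  let ?h = "\<lambda>x. f x + ext_comp g F x"
  let ?D = "\<lambda>v y p. fenchel_conj g v + fenchel_conj f y + fenchel_conj (scalarization v F) (p - y)"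
  note f_nM = proper_convexD(1)[OF assms(9)] and g_nM = proper_convexD(1)[OF assms(7)]
  have conv: "convex (K_epi K F)"
    using assms(6) by (simp add: K_convex_def)
  have mono: "\<And>x y. (x, y) \<in> K_epi K F \<Longrightarrow> ext_comp g F x \<le> g y"
    using assms(8) by auto
  have weak: "fenchel_conj ?h p \<le> ?D v y p" for p v y
    by (rule composite_conj_le) (rule f_nM g_nM)+
  have attained: "\<exists>v y. v \<in> uminus ` polar K \<and> ?D v y p = fenchel_conj ?h p"
    if Q: "qualification K f g F" for p
  proof (cases "fenchel_conj ?h p")
    case (real m)
    then show ?thesis
      using composite_dual_attained[OF assms(1,3,4) conv assms(7,9) mono Q, of p m] weak
      by (metis order_antisym order_refl)
  next
    case PInf
    \<comment> \<open>By weak duality every dual value is infinite here, so any admissible pair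
      attains the minimum.\<close>
    have "0 \<in> uminus ` polar K"
      by (force simp: polar_def)
    with weak[of p 0 0] PInf show ?thesis
      by (intro exI[of _ 0] conjI) auto
  next
    case MInf
    with composite_conj_not_MInf[OF assms(9) mono Q] show ?thesis
      by simp
  qed
  have a: "is_minimum (fenchel_conj ?h p) {?D v y p | v y. v \<in> uminus ` polar K}"
    if "qualification K f g F" for p
    unfolding is_minimum_def using attained[OF that, of p] weak by (smt (verit) mem_Collect_eq)
  have h_nM: "?h x \<noteq> -\<infinity>" for x
    using f_nM[of x] ext_comp_not_MInf[of g F x, OF g_nM] by simp
  have b: "subdiff f x + (\<Union>v\<in>subdiff g (the (F x)). subdiff (scalarization v F) x) \<subseteq> subdiff ?h x \<and>
     (qualification K f g F \<longrightarrow>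
       subdiff ?h x = subdiff f x + (\<Union>v\<in>subdiff g (the (F x)). subdiff (scalarization v F) x))"
    if x: "x \<in> edom f \<inter> edom (ext_comp g F)" for x
  proof -
    obtain \<alpha> where \<alpha>: "f x = ereal \<alpha>"
      using x edom_real[of x f] f_nM by (metis IntD1)
    obtain z where z: "F x = Some z" and "z \<in> edom g"
      using x by (auto simp: edom_def ext_comp_def split: option.splits)
    then obtain \<beta> where \<beta>: "g z = ereal \<beta>"
      using edom_real[of z g] g_nM by metis
    have h: "?h x = ereal (\<alpha> + \<beta>)" and s: "scalarization v F x = ereal (v \<bullet> z)" for v
      by (simp_all add: \<alpha> \<beta> z ext_comp_def scalarization_def)
    note sub_f = subdiff_iff_fenchel_conj[where f = f, OF f_nM \<alpha>]
      and sub_g = subdiff_iff_fenchel_conj[where f = g, OF g_nM \<beta>]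
      and sub_h = subdiff_iff_fenchel_conj[where f = ?h, OF h_nM h]
      and sub_s = subdiff_iff_fenchel_conj[where f = "scalarization v F" for v, OF scalarization_not_MInf s]
    have sub: "subdiff f x + (\<Union>v\<in>subdiff g (the (F x)). subdiff (scalarization v F) x) \<subseteq> subdiff ?h x"
    proof
      fix p assume "p \<in> subdiff f x + (\<Union>v\<in>subdiff g (the (F x)). subdiff (scalarization v F) x)"
      then obtain y v t where p: "p = y + t" and "y \<in> subdiff f x" "v \<in> subdiff g z"
        "t \<in> subdiff (scalarization v F) x"
        using z by (auto elim!: set_plus_elim)
      then have "?D v y p \<le> ereal (v \<bullet> z - \<beta>) + ereal (y \<bullet> x - \<alpha>) + ereal (t \<bullet> x - v \<bullet> z)"
        unfolding sub_f sub_g sub_s by (intro add_mono) simp_all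
      then have "?D v y p \<le> ereal (p \<bullet> x - (\<alpha> + \<beta>))"
        by (simp add: p inner_add_left algebra_simps)
      then show "p \<in> subdiff ?h x"
        unfolding sub_h using weak order_trans by blast
    qed
    moreover have "p \<in> subdiff f x + (\<Union>v\<in>subdiff g (the (F x)). subdiff (scalarization v F) x)"
      if Q: "qualification K f g F" and p: "p \<in> subdiff ?h x" for p
    proof -
      obtain v y where "?D v y p = fenchel_conj ?h p"
        using attained[OF Q] by blast
      then have D: "?D v y p \<le> ereal (p \<bullet> x - (\<alpha> + \<beta>))"
        using p unfolding sub_h by simp
      have ge: "ereal (v \<bullet> z - \<beta>) \<le> fenchel_conj g v" "ereal (y \<bullet> x - \<alpha>) \<le> fenchel_conj f y"
        "ereal ((p - y) \<bullet> x - v \<bullet> z) \<le> fenchel_conj (scalarization v F) (p - y)"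
        using fenchel_conj_ge[of v z g] fenchel_conj_ge[of y x f]
          fenchel_conj_ge[of "p - y" x "scalarization v F"] by (simp_all add: \<alpha> \<beta> s)
      \<comment> \<open>The three lower bounds in \<open>ge\<close> add up to exactly the upper
        bound in \<open>D\<close>, so each of them is an equality.\<close>
      have "fenchel_conj g v \<le> ereal (v \<bullet> z - \<beta>) \<and> fenchel_conj f y \<le> ereal (y \<bullet> x - \<alpha>) \<and>
        fenchel_conj (scalarization v F) (p - y) \<le> ereal ((p - y) \<bullet> x - v \<bullet> z)"
        using D ge
        by (cases "fenchel_conj g v"; cases "fenchel_conj f y";
            cases "fenchel_conj (scalarization v F) (p - y)") (auto simp: inner_diff_left)
      then have "v \<in> subdiff g (the (F x))" "y \<in> subdiff f x" "p - y \<in> subdiff (scalarization v F) x"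
        by (simp_all add: z sub_f sub_g sub_s)
      then have "y + (p - y) \<in> subdiff f x + (\<Union>v\<in>subdiff g (the (F x)). subdiff (scalarization v F) x)"
        by (intro set_plus_intro) auto
      then show ?thesis
        by simp
    qed
    ultimately show ?thesis
      by blast
  qed
  show ?thesis
    by (intro conjI[OF _ ballI] impI allI a b)
qed

end
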